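(* Let $n \ge 3$ be an integer. There exists a non-trivial $n\times n$ chessboard satisfying the neighbor-sum property if and only if $6 \mid (n+1)$.
   Context: An $n\times n$ chessboard is an assignment of an integer $x_{ij}\in\mathbb{Z}$ to each square $(i,j)$ with $1\le i,j\le n$. Two distinct squares are neighbors if they share a common edge or a common vertex, i.e. $(i,j)\ne(i',j')$, $|i-i'|\le 1$ and $|j-j'|\le 1$. The chessboard satisfies the neighbor-sum property if the number on each square equals the sum of the numbers on all its neighboring squares. It is trivial if all its entries are $0$, and non-trivial otherwise. *)

theory Defs
  imports Main
begin

definition squares :: "nat \<Rightarrow> (nat \<times> nat) set" where
  "squares n = {1..n} \<times> {1..n}"

definition neighbors :: "nat \<times> nat \<Rightarrow> nat \<times> nat \<Rightarrow> bool" where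
  "neighbors s t \<longleftrightarrow> s \<noteq> t
     \<and> \<bar>int (fst s) - int (fst t)\<bar> \<le> 1 \<and> \<bar>int (snd s) - int (snd t)\<bar> \<le> 1"

text \<open>A chessboard of size \<open>n\<close> is a function on pairs of which only the values on
  \<open>squares n\<close> matter; the values elsewhere are never constrained or inspected.\<close>

definition neighbor_sum_property :: "nat \<Rightarrow> (nat \<times> nat \<Rightarrow> int) \<Rightarrow> bool" where
  "neighbor_sum_property n x \<longleftrightarrow>
     (\<forall>s\<in>squares n. x s = (\<Sum>t\<in>{t \<in> squares n. neighbors s t}. x t))"

definition trivial_board :: "nat \<Rightarrow> (nat \<times> nat \<Rightarrow> int) \<Rightarrow> bool" where
  "trivial_board n x \<longleftrightarrow> (\<forall>s\<in>squares n. x s = 0)"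

end

theory Submission
  imports Defs Complex_Main "HOL-Computational_Algebra.Polynomial"
begin

text \<open>
  Adding the number on a square to both sides turns the property into \<open>(A \<otimes> A) x = 2 x\<close>, where
  \<open>A\<close> is the identity plus the adjacency matrix of a path. The discrete sine transform
  diagonalises \<open>A\<close>, so a non-trivial board forces \<open>l m = 2\<close> with \<open>l = 1 + z + 1/z\<close>,
  \<open>m = 1 + w + 1/w\<close> and \<open>z\<close>, \<open>w\<close> roots of unity of order dividing \<open>2 (n + 1)\<close>.

  Squaring \<open>z\<close> maps \<open>l\<close> to \<open>l (l - 2)\<close>, and this orbit is eventually periodic. If it avoids \<open>0\<close>,
  the product of the factors \<open>l\<^sub>i - 2\<close> over a period is 1; modulo \<open>l\<close> it is a power of \<open>- 2\<close>,
  and \<open>l\<close> divides 2, so \<open>l\<close> is a unit. If it reaches \<open>0\<close>, it passes through 2 just before; as long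
  as \<open>l\<^sub>i\<close> divides 2, \<open>l\<^sub>i\<^sup>2\<close> divides \<open>l\<^sub>i\<^sub>+\<^sub>1\<close>, so a long way to 2 makes a high power of \<open>l\<close>
  divide 2. Since 2 is not invertible in \<open>\<int>[\<xi>]\<close>, comparing both orbits leaves only \<open>{l, m} = {1, 2}\<close>.
  Then \<open>z\<close> and \<open>w\<close> have orders 4 and 6, so 12 divides \<open>2 (n + 1)\<close>. Conversely, the product of
  sequences of periods 4 and 6 is a board.
\<close>

text \<open>
  A finitely generated group \<open>G\<close> with \<open>G = 2 G\<close> vanishes. The odd multipliers \<open>d\<close> let one
  eliminate the last generator without dividing.
\<close>
lemma zero_if_twice_combination:
  fixes g :: "nat \<Rightarrow> 'a :: {idom, ring_char_0}"
  assumes "\<And>i. i < m \<Longrightarrow> \<exists>d a. odd (d :: int) \<and> of_int d * g i = 2 * (\<Sum>k<m. of_int (a k) * g k)"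
  shows "i < m \<Longrightarrow> g i = 0"
  using assms
proof (induction m arbitrary: i)
  case 0
  then show ?case by simp
next
  case (Suc m)
  obtain d a where d: "odd d" "of_int d * g m = 2 * (\<Sum>k<Suc m. of_int (a k) * g k)"
    using Suc.prems(2)[of m] by auto
  \<comment> \<open>Moving the \<open>g m\<close> term of the right-hand side to the left changes
    the odd \<open>d\<close> by an even number, so \<open>e\<close> stays odd.\<close>
  define e where "e = d - 2 * a m"
  have e: "odd e" "of_int e * g m = 2 * (\<Sum>k<m. of_int (a k) * g k)"
    using d by (auto simp: e_def algebra_simps)
  have less: "g k = 0" if k: "k < m" for k
  proof (rule Suc.IH[OF k])
    fix i assume "i < m"
    then obtain d' b where b: "odd d'" "of_int d' * g i = 2 * (\<Sum>k<Suc m. of_int (b k) * g k)"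
      using Suc.prems(2)[of i] by auto
    \<comment> \<open>The extra factor \<open>e\<close> lets \<open>of_int e * g m\<close> be
      replaced by a combination of the earlier generators.\<close>
    have "of_int (e * d') * g i = of_int e * (of_int d' * g i)"
      by simp
    also have "\<dots> = 2 * ((\<Sum>k<m. of_int (e * b k) * g k) + of_int (b m) * (of_int e * g m))"
      unfolding b by (simp add: algebra_simps sum_distrib_left)
    also have "\<dots> = 2 * (\<Sum>k<m. of_int (e * b k + 2 * b m * a k) * g k)"
      unfolding e by (simp add: algebra_simps sum_distrib_left sum.distrib)
    finally show "\<exists>d a. odd d \<and> of_int d * g i = 2 * (\<Sum>k<m. of_int (a k) * g k)"
      using e(1) b(1) by (intro exI[of _ "e * d'"] exI[of _ "\<lambda>k. e * b k + 2 * b m * a k"]) simp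
  qed
  moreover have "g m = 0"
    using e less by (auto simp: sum.neutral)
  ultimately show ?case
    using Suc.prems(1) by (auto simp: less_Suc_eq)
qed

section \<open>Orbits of \<open>l (l - 2)\<close> in a subring where 2 is not invertible\<close>

locale half_free_subring =
  fixes S :: "'a :: {idom, ring_char_0} set"
  assumes one: "1 \<in> S"
    and add: "x \<in> S \<Longrightarrow> y \<in> S \<Longrightarrow> x + y \<in> S"
    and uminus: "x \<in> S \<Longrightarrow> - x \<in> S"
    and mult: "x \<in> S \<Longrightarrow> y \<in> S \<Longrightarrow> x * y \<in> S"
    and no_half: "x \<in> S \<Longrightarrow> 2 * x \<noteq> 1"
begin

lemma diff: "x \<in> S \<Longrightarrow> y \<in> S \<Longrightarrow> x - y \<in> S"
  using add[of x "- y"] uminus by simp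

lemma two: "2 \<in> S"
  using add[OF one one] by simp

lemma power: "x \<in> S \<Longrightarrow> x ^ k \<in> S"
  by (induction k) (auto intro: one mult)

lemmas closed = one two add uminus diff mult power

definition orbit :: "(nat \<Rightarrow> 'a) \<Rightarrow> bool" where
  "orbit l \<longleftrightarrow> l 0 \<in> S \<and> (\<forall>i. l (Suc i) = l i * (l i - 2))"

lemma orbit_mem: "orbit l \<Longrightarrow> l i \<in> S"
  by (induction i) (auto simp: orbit_def intro!: closed)

lemma orbit_multiple:
  assumes "orbit l"
  shows "\<exists>c\<in>S. l (i + d) = l i * c"
proof (induction d)
  case 0
  show ?case using one by (auto intro: bexI[of _ 1])
next
  case (Suc d)
  then obtain c where "c \<in> S" "l (i + d) = l i * c" by blast
  with assms show ?case
    by (intro bexI[of _ "c * (l (i + d) - 2)"]) (auto simp: orbit_def mult.assoc intro!: closed orbit_mem[OF assms])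
qed

lemma orbit_zero_or_unit:
  assumes l: "orbit l" and m: "m \<in> S" "l 0 * m = 2" and per: "l (j + r) = l j" "r > 0"
  shows "(\<exists>k. l k = 0) \<or> (\<exists>u\<in>S. l 0 * u = 1)"
proof (cases "l j = 0")
  case False
  have prod: "l (j + d) = l j * (\<Prod>i<d. l (j + i) - 2)" for d
    using l by (induction d) (auto simp: orbit_def)
  have "(\<Prod>i<r. l (j + i) - 2) = 1"
    using prod[of r] per False by simp
  \<comment> \<open>Each factor is \<open>- 2\<close> modulo \<open>l 0\<close>, because
    \<open>l 0\<close> divides every term of the orbit.\<close>
  moreover have "\<exists>c\<in>S. (\<Prod>i<d. l (j + i) - 2) = (- 2) ^ d + l 0 * c" for d
  proof (induction d)
    case 0
    show ?case using diff[OF one one] by (auto intro: bexI[of _ 0])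
  next
    case (Suc d)
    then obtain c where c: "c \<in> S" "(\<Prod>i<d. l (j + i) - 2) = (- 2) ^ d + l 0 * c" by blast
    obtain b where b: "b \<in> S" "l (j + d) = l 0 * b"
      using orbit_multiple[OF l, of 0 "j + d"] by auto
    have "(\<Prod>i<Suc d. l (j + i) - 2) = (- 2) ^ Suc d + l 0 * ((-2)^d * b + l (j + d) * c - 2 * c)"
      using c b by (simp add: algebra_simps)
    moreover have "(-2)^d * b + l (j + d) * c - 2 * c \<in> S"
      using b c by (intro closed orbit_mem[OF l]) auto
    ultimately show ?case by blast
  qed
  ultimately obtain c where c: "c \<in> S" "(- 2) ^ r + l 0 * c = 1"
    by metis
  obtain r' where r': "r = Suc r'" using per by (cases r) auto
  \<comment> \<open>Since \<open>r > 0\<close>, one factor of \<open>(- 2) ^ r\<close> can be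
    written as \<open>- (l 0 * m)\<close>, which exposes the inverse of \<open>l 0\<close>.\<close>
  have "l 0 * (c - m * (- 2) ^ r') = l 0 * c - (l 0 * m) * (- 2) ^ r'"
    by (simp add: algebra_simps)
  also have "\<dots> = (- 2) ^ r + l 0 * c"
    unfolding m(2) r' by simp
  also note c(2)
  finally have "l 0 * (c - m * (- 2) ^ r') = 1" .
  moreover have "c - m * (- 2) ^ r' \<in> S"
    using c m by (intro closed) auto
  ultimately show ?thesis by blast
qed blast

text \<open>From \<open>2 = l i * c\<close> follows \<open>l i - 2 = l i * (1 - c)\<close>, a second
  factor \<open>l i\<close>.\<close>

lemma orbit_square:
  assumes "orbit l" "c \<in> S" "l i * c = 2"
  shows "\<exists>b\<in>S. l (Suc i) = l i ^ 2 * b"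
proof
  have "l i * (l i - 2) = l i ^ 2 * (1 - c)"
    by (simp only: assms(3)[symmetric]) (simp add: power2_eq_square algebra_simps)
  with assms show "l (Suc i) = l i ^ 2 * (1 - c)"
    by (auto simp: orbit_def)
qed (use assms in \<open>auto intro: closed\<close>)

text \<open>The predecessor of the first zero is itself nonzero, so its factor
  \<open>l k - 2\<close> must vanish.\<close>

lemma orbit_first_zero:
  assumes "orbit l" "l k = 0" "l 0 \<noteq> 0"
  obtains k where "l k = 2"
proof -
  define k0 where "k0 = (LEAST k. l k = 0)"
  have k0: "l k0 = 0"
    unfolding k0_def using assms(2) by (rule LeastI)
  have least: "l i \<noteq> 0" if "i < k0" for i
    using not_less_Least[OF that[unfolded k0_def]] .
  have "k0 \<noteq> 0" using k0 assms(3) by metis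
  then obtain k where k: "k0 = Suc k" by (cases k0) auto
  have "l k * (l k - 2) = 0" using k0 k assms(1) by (simp add: orbit_def)
  then have "l k = 2" using least[of k] k by simp
  then show ?thesis by (rule that)
qed

lemma orbit_dvd_two:
  assumes "orbit l" "l k = 2" "i \<le> k"
  shows "\<exists>c\<in>S. l i * c = 2"
proof -
  obtain c where "c \<in> S" "l (i + (k - i)) = l i * c"
    using orbit_multiple[OF assms(1)] by blast
  with assms(2,3) show ?thesis by auto
qed

text \<open>All terms up to \<open>k\<close> divide 2, so \<open>orbit_square\<close> applies
  repeatedly and doubles the exponent of \<open>l 0\<close> at each step.\<close>

lemma orbit_power_dvd_two:
  assumes "orbit l" "l k = 2" "i \<le> k"
  shows "\<exists>c\<in>S. l 0 ^ (2 ^ i) * c = 2"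
proof -
  have "\<exists>c\<in>S. l i = l 0 ^ (2 ^ i) * c"
    using assms(3)
  proof (induction i)
    case 0
    show ?case using one by (auto intro: bexI[of _ 1])
  next
    case (Suc i)
    then obtain c where c: "c \<in> S" "l i = l 0 ^ (2 ^ i) * c" by auto
    obtain e where "e \<in> S" "l i * e = 2"
      using orbit_dvd_two[OF assms(1,2)] Suc.prems by (meson Suc_leD)
    from orbit_square[OF assms(1) this] obtain b where b: "b \<in> S" "l (Suc i) = l i ^ 2 * b" by blast
    have "l (Suc i) = l 0 ^ (2 ^ Suc i) * (c ^ 2 * b)"
      unfolding b c by (simp add: power_mult_distrib power_mult[symmetric] mult_ac)
    moreover have "c ^ 2 * b \<in> S" using b c by (intro closed)
    ultimately show ?case by blast
  qed
  then obtain c where c: "c \<in> S" "l i = l 0 ^ (2 ^ i) * c" by blast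
  obtain e where e: "e \<in> S" "l i * e = 2" using orbit_dvd_two[OF assms] by blast
  have "l 0 ^ (2 ^ i) * (c * e) = 2" using c e by (simp add: mult.assoc)
  with mult[OF c(1) e(1)] show ?thesis by blast
qed

text \<open>Here \<open>m 0 = 2 * u\<close>, so \<open>m 1\<close> is a multiple of 4. If the orbit
  reached 2 only later, \<open>m 1\<close> would divide 2, making 2 invertible.\<close>

lemma orbit_two_if_cofactor_unit:
  assumes m: "orbit m" "m k = 2" and l: "l * m 0 = 2" "u \<in> S" "l * u = 1"
  shows "m 0 = 2"
proof (cases k)
  case (Suc k')
  have "m 0 = (l * u) * m 0" using l by simp
  also have "\<dots> = (l * m 0) * u" by (simp only: mult_ac)
  finally have m0: "m 0 = 2 * u" using l by simp
  have "m 1 = 4 * (u * (u - 1))"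
  proof -
    have "m 1 = m 0 * (m 0 - 2)" using m(1) by (auto simp: orbit_def)
    then show ?thesis unfolding m0 by (simp add: algebra_simps)
  qed
  moreover obtain c where c: "c \<in> S" "m 1 * c = 2"
    using orbit_dvd_two[OF m, of 1] Suc by auto
  ultimately have "2 * (2 * (u * (u - 1) * c)) = 2 * 1" by (simp add: mult_ac)
  then have "2 * (u * (u - 1) * c) = 1" unfolding mult_cancel_left by simp
  moreover have "u * (u - 1) * c \<in> S" using c l by (intro closed)
  ultimately show ?thesis using no_half by blast
qed (use m in auto)

text \<open>Both \<open>l 0 ^ 4\<close> and \<open>m 0 ^ 2\<close> divide 2. Hence
  \<open>(l 0 * m 0) ^ 4 = 16\<close> divides \<open>2 * 2 ^ 2 = 8\<close>, which would make 2
  invertible.\<close>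

lemma orbits_product_not_two:
  assumes l: "orbit l" "l j = 2" "2 \<le> j" and m: "orbit m" "m k = 2" "1 \<le> k" and lm: "l 0 * m 0 = 2"
  shows False
proof -
  obtain c where c: "c \<in> S" "l 0 ^ 2 ^ 2 * c = 2" using orbit_power_dvd_two[OF l] by blast
  obtain d where d: "d \<in> S" "m 0 ^ 2 ^ 1 * d = 2" using orbit_power_dvd_two[OF m] by blast
  have "8 = (2 :: 'a) * 2 ^ 2" by simp
  also have "\<dots> = (l 0 ^ 2 ^ 2 * c) * (m 0 ^ 2 ^ 1 * d) ^ 2" unfolding c(2) d(2) ..
  also have "\<dots> = (l 0 * m 0) ^ 4 * (c * d ^ 2)" by (simp add: power_mult_distrib mult_ac flip: power_mult)
  also have "\<dots> = 8 * (2 * (c * d ^ 2))" using lm by simp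
  finally have "2 * (c * d ^ 2) = 1" by simp
  moreover have "c * d ^ 2 \<in> S" using c d by (intro closed)
  ultimately show False using no_half by blast
qed

text \<open>The cases are which of \<open>l 0\<close> and \<open>m 0\<close> are units. Two units
  would make 2 a unit; a single unit forces the other value to be 2; with no unit, both orbits reach
  2 and the times at which they do are compared.\<close>

lemma orbits_product_two:
  assumes l: "orbit l" "l (j + r) = l j" "r > 0"
    and m: "orbit m" "m (j' + r') = m j'" "r' > 0"
    and lm: "l 0 * m 0 = 2"
  shows "l 0 = 1 \<and> m 0 = 2 \<or> l 0 = 2 \<and> m 0 = 1"
proof -
  have ml: "m 0 * l 0 = 2" using lm by (simp add: mult.commute)
  have nz: "l 0 \<noteq> 0" "m 0 \<noteq> 0" using lm by auto
  have L: "(\<exists>k. l k = 2) \<or> (\<exists>u\<in>S. l 0 * u = 1)"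
    using orbit_zero_or_unit[OF l(1) orbit_mem[OF m(1)] lm l(2,3)] orbit_first_zero[OF l(1)] nz
    by metis
  have M: "(\<exists>k. m k = 2) \<or> (\<exists>u\<in>S. m 0 * u = 1)"
    using orbit_zero_or_unit[OF m(1) orbit_mem[OF l(1)] ml m(2,3)] orbit_first_zero[OF m(1)] nz
    by metis
  have "l 0 = 2 \<or> m 0 = 2"
  proof (cases "\<exists>u\<in>S. l 0 * u = 1")
    case True
    then obtain u where u: "u \<in> S" "l 0 * u = 1" by blast
    show ?thesis
    proof (cases "\<exists>v\<in>S. m 0 * v = 1")
      case True
      then obtain v where v: "v \<in> S" "m 0 * v = 1" by blast
      have "2 * (u * v) = (l 0 * u) * (m 0 * v)" unfolding lm[symmetric] by (simp only: mult_ac)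
      then have "2 * (u * v) = 1" using u v by simp
      with no_half mult[OF u(1) v(1)] show ?thesis by blast
    next
      case False
      then show ?thesis using M orbit_two_if_cofactor_unit[OF m(1) _ lm u] by blast
    qed
  next
    case False
    then obtain k where k: "l k = 2" using L by blast
    show ?thesis
    proof (cases "\<exists>v\<in>S. m 0 * v = 1")
      case True
      then show ?thesis using orbit_two_if_cofactor_unit[OF l(1) k ml] by blast
    next
      case False
      then obtain k' where k': "m k' = 2" using M by blast
      show ?thesis
      proof (rule ccontr)
        assume neg: "\<not> ?thesis"
        then have pos: "k \<noteq> 0" "k' \<noteq> 0" using k k' by metis+
        have "\<not> 2 \<le> k" using orbits_product_not_two[OF l(1) k _ m(1) k' _ lm] pos by auto
        moreover have "\<not> 2 \<le> k'" using orbits_product_not_two[OF m(1) k' _ l(1) k _ ml] pos by auto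
        \<comment> \<open>What remains is that both orbits are at 2 after exactly one step.
          Multiplying the two equations gives \<open>l 0 + m 0 = 2\<close>, so
          \<open>l 0 * (l 0 - 2)\<close> is \<open>- 2\<close> as well as 2.\<close>
        ultimately have "k = Suc 0" "k' = Suc 0" using pos by auto
        then have sq: "l 0 * (l 0 - 2) = 2" "m 0 * (m 0 - 2) = 2" using k k' l(1) m(1)
          by (auto simp: orbit_def)
        have "2 * ((l 0 - 2) * (m 0 - 2)) = 2 * 2"
        proof -
          have "2 * ((l 0 - 2) * (m 0 - 2)) = (l 0 * (l 0 - 2)) * (m 0 * (m 0 - 2))"
            unfolding lm[symmetric] by (simp only: mult_ac)
          then show ?thesis unfolding sq .
        qed
        then have "(l 0 - 2) * (m 0 - 2) = 2" unfolding mult_cancel_left by simp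
        then have "2 * (2 - m 0) = 2 * l 0" using lm by (simp add: algebra_simps)
        then have "l 0 = 2 - m 0" unfolding mult_cancel_left by simp
        then have "l 0 - 2 = - m 0" by simp
        then have "l 0 * (l 0 - 2) = - 2" using lm by (simp only: mult_minus_right)
        then have "(2::'a) = -2" using sq by simp
        then have "(4::'a) = 0" by (simp add: eq_neg_iff_add_eq_0)
        then show False by simp
      qed
    qed
  qed
  then show ?thesis
  proof
    assume "l 0 = 2"
    with lm have "2 * m 0 = 2 * 1" by simp
    then show ?thesis using \<open>l 0 = 2\<close> unfolding mult_cancel_left by simp
  next
    assume "m 0 = 2"
    with ml have "2 * l 0 = 2 * 1" by simp
    then show ?thesis using \<open>m 0 = 2\<close> unfolding mult_cancel_left by simp
  qed
qed

end

section \<open>The ring generated by a root of unity\<close>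

text \<open>This is \<open>\<int>[\<xi>]\<close> when \<open>\<xi> ^ M = 1\<close> and
  \<open>M > 0\<close>. Bounding the exponents exhibits it as a finitely generated group.\<close>

definition root_ring :: "nat \<Rightarrow> complex \<Rightarrow> complex set" where
  "root_ring M \<xi> = range (\<lambda>a :: nat \<Rightarrow> int. \<Sum>k<M. of_int (a k) * \<xi> ^ k)"

lemma root_ring_power:
  assumes "\<xi> ^ M = 1" "M > 0"
  shows "of_int c * \<xi> ^ j \<in> root_ring M \<xi>"
proof -
  have "\<xi> ^ j = \<xi> ^ (M * (j div M) + j mod M)" by simp
  also have "\<dots> = \<xi> ^ (j mod M)"
    unfolding power_add power_mult using assms by simp
  finally have "of_int c * \<xi> ^ j = of_int c * \<xi> ^ (j mod M)" by simp
  also have "\<dots> = (\<Sum>k<M. of_int (if k = j mod M then c else 0) * \<xi> ^ k)"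
    using assms(2) by (simp add: if_distrib if_distribR sum.delta cong: if_cong)
  finally show ?thesis by (auto simp: root_ring_def)
qed

lemma root_ring_add:
  assumes "x \<in> root_ring M \<xi>" "y \<in> root_ring M \<xi>"
  shows "x + y \<in> root_ring M \<xi>"
proof -
  obtain a b where "x = (\<Sum>k<M. of_int (a k) * \<xi> ^ k)" "y = (\<Sum>k<M. of_int (b k) * \<xi> ^ k)"
    using assms by (auto simp: root_ring_def)
  then have "x + y = (\<Sum>k<M. of_int (a k + b k) * \<xi> ^ k)"
    by (simp add: sum.distrib algebra_simps)
  then show ?thesis
    unfolding root_ring_def by (rule image_eqI[of _ _ "\<lambda>k. a k + b k"]) simp
qed

lemma root_ring_sum:
  assumes "\<And>i. i \<in> A \<Longrightarrow> f i \<in> root_ring M \<xi>"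
  shows "sum f A \<in> root_ring M \<xi>"
proof -
  have "0 \<in> root_ring M \<xi>"
    unfolding root_ring_def by (rule image_eqI[of _ _ "\<lambda>_. 0"]) auto
  with assms show ?thesis
    by (induction A rule: infinite_finite_induct) (auto intro: root_ring_add)
qed

text \<open>If \<open>2 * x = 1\<close>, each generator \<open>\<xi> ^ i\<close> is twice the ring
  element \<open>x * \<xi> ^ i\<close>, so \<open>zero_if_twice_combination\<close> kills all
  generators, including \<open>\<xi> ^ 0 = 1\<close>.\<close>

lemma half_free_root_ring:
  assumes "\<xi> ^ M = 1" "M > 0"
  shows "half_free_subring (root_ring M \<xi>)"
proof
  show "1 \<in> root_ring M \<xi>"
    using root_ring_power[OF assms, of 1 0] by simp
next
  fix x y assume "x \<in> root_ring M \<xi>" "y \<in> root_ring M \<xi>"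
  then show "x + y \<in> root_ring M \<xi>" by (rule root_ring_add)
next
  fix x assume "x \<in> root_ring M \<xi>"
  then obtain a where "x = (\<Sum>k<M. of_int (a k) * \<xi> ^ k)" by (auto simp: root_ring_def)
  then have "- x = (\<Sum>k<M. of_int (- a k) * \<xi> ^ k)" by (simp add: sum_negf)
  then show "- x \<in> root_ring M \<xi>"
    unfolding root_ring_def by (rule image_eqI[of _ _ "\<lambda>k. - a k"]) simp
next
  show mult: "x * y \<in> root_ring M \<xi>" if xy: "x \<in> root_ring M \<xi>" "y \<in> root_ring M \<xi>" for x y
  proof -
    obtain a b where "x = (\<Sum>k<M. of_int (a k) * \<xi> ^ k)" "y = (\<Sum>k<M. of_int (b k) * \<xi> ^ k)"
      using xy by (auto simp: root_ring_def)
    then have "x * y = (\<Sum>k<M. \<Sum>j<M. of_int (a k * b j) * \<xi> ^ (k + j))"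
      by (simp add: sum_product power_add mult_ac)
    also have "\<dots> \<in> root_ring M \<xi>"
      by (intro root_ring_sum root_ring_power assms)
    finally show ?thesis .
  qed
  show "2 * x \<noteq> 1" if x: "x \<in> root_ring M \<xi>" for x
  proof
    assume half: "2 * x = 1"
    have "\<xi> ^ 0 = 0"
    proof (rule zero_if_twice_combination[where m = M])
      fix i
      have "x * \<xi> ^ i \<in> root_ring M \<xi>"
        using mult[OF x root_ring_power[OF assms, of 1 i]] by simp
      then obtain a where "x * \<xi> ^ i = (\<Sum>k<M. of_int (a k) * \<xi> ^ k)"
        by (auto simp: root_ring_def)
      moreover have "\<xi> ^ i = 2 * (x * \<xi> ^ i)" using half by (simp flip: mult.assoc)
      ultimately have "of_int 1 * \<xi> ^ i = 2 * (\<Sum>k<M. of_int (a k) * \<xi> ^ k)"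
        by simp
      then show "\<exists>d a. odd d \<and> of_int d * \<xi> ^ i = 2 * (\<Sum>k<M. of_int (a k) * \<xi> ^ k)"
        by (metis odd_one)
    qed (use assms in auto)
    then show False by simp
  qed
qed

section \<open>Roots of unity under repeated squaring\<close>

lemma roots_of_unity_power_primitive:
  assumes "M > 0"
  obtains \<xi> :: complex where "\<xi> ^ M = 1" "\<And>z. z ^ M = 1 \<Longrightarrow> \<exists>k. z = \<xi> ^ k"
proof
  let ?x = "cis (2 * pi / real M)"
  show "?x ^ M = 1" using assms by (simp add: DeMoivre)
  fix z :: complex assume "z ^ M = 1"
  then obtain k where "z = cis (2 * pi * real k / real M)"
    using bij_betw_imp_surj_on[OF bij_betw_roots_unity[OF assms]] by blast
  then have "z = ?x ^ k" by (simp add: DeMoivre mult_ac)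
  then show "\<exists>k. z = ?x ^ k" ..
qed

text \<open>With \<open>a = z ^ 2 ^ i\<close> and \<open>s = a + 1/a\<close>, this is
  \<open>(1 + s) * (s - 1) = s^2 - 1 = 1 + a^2 + 1/a^2\<close>.\<close>

lemma doubling_orbit:
  fixes z :: complex
  assumes "z \<noteq> 0"
  defines "l \<equiv> \<lambda>i. 1 + z ^ 2 ^ i + inverse z ^ 2 ^ i"
  shows "l (Suc i) = l i * (l i - 2)"
proof -
  have "z ^ 2 ^ i * inverse z ^ 2 ^ i = 1"
    using assms by (simp flip: power_mult_distrib)
  then show ?thesis
    unfolding l_def power_Suc2 power_mult by (simp add: power2_eq_square algebra_simps)
qed

text \<open>Squaring stays inside the finite set of \<open>M\<close>-th roots of unity, so some
  value repeats. It need not be injective there, hence the preperiod \<open>j\<close>.\<close>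

lemma doubling_periodic:
  fixes z :: complex
  assumes "z ^ M = 1" "M > 0"
  obtains j r where "r > 0" "z ^ 2 ^ (j + r) = z ^ 2 ^ j"
proof -
  have "range (\<lambda>i :: nat. z ^ 2 ^ i) \<subseteq> {w. w ^ M = 1}"
    using assms by (auto simp flip: power_mult) (metis mult.commute power_mult power_one)
  then have "finite (range (\<lambda>i :: nat. z ^ 2 ^ i))"
    using finite_roots_unity[of M] assms by (auto intro: finite_subset)
  then have "\<not> inj (\<lambda>i :: nat. z ^ 2 ^ i)"
    using finite_imageD by blast
  then obtain a b :: nat where "a < b" "z ^ 2 ^ a = z ^ 2 ^ b"
    unfolding inj_def by (metis linorder_neqE_nat)
  then show ?thesis by (intro that[of "b - a" a]) auto
qed

lemma roots_of_unity_product_two: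
  fixes z w :: complex
  assumes z: "z ^ M = 1" and w: "w ^ M = 1" and M: "M > 0"
    and eq: "(1 + z + inverse z) * (1 + w + inverse w) = 2"
  shows "1 + z + inverse z = 1 \<and> 1 + w + inverse w = 2 \<or>
         1 + z + inverse z = 2 \<and> 1 + w + inverse w = 1"
proof -
  obtain \<xi> :: complex where \<xi>: "\<xi> ^ M = 1" "\<And>z. z ^ M = 1 \<Longrightarrow> \<exists>k. z = \<xi> ^ k"
    using roots_of_unity_power_primitive[OF M] by blast
  interpret half_free_subring "root_ring M \<xi>"
    using half_free_root_ring \<xi>(1) M .
  define l where "l = (\<lambda>(z :: complex) i. 1 + z ^ 2 ^ i + inverse z ^ 2 ^ i)"
  have l: "orbit (l z) \<and> (\<exists>j r. l z (j + r) = l z j \<and> r > 0)" if z: "z ^ M = 1" for z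
  proof -
    have mem: "y \<in> root_ring M \<xi>" if "y ^ M = 1" for y
      using \<xi>(2)[OF that] root_ring_power[OF \<xi>(1) M, of 1] by auto
    have "z \<noteq> 0" using z M by (auto simp: zero_power)
    then have "orbit (l z)"
      using mem[OF z] mem[of "inverse z"] z doubling_orbit[of z]
      by (auto simp: orbit_def l_def power_inverse intro!: add one)
    moreover obtain j r where "r > 0" "z ^ 2 ^ (j + r) = z ^ 2 ^ j"
      using doubling_periodic[OF z M] .
    then have "l z (j + r) = l z j" by (simp add: l_def power_inverse)
    ultimately show ?thesis using \<open>r > 0\<close> by blast
  qed
  have "l z 0 * l w 0 = 2" using eq by (simp add: l_def)
  then have "l z 0 = 1 \<and> l w 0 = 2 \<or> l z 0 = 2 \<and> l w 0 = 1"
    using l[OF z] l[OF w] orbits_product_two by blast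
  then show ?thesis by (simp add: l_def)
qed

section \<open>Orders of the two roots of unity\<close>

lemma dvd_exponent_if_unity:
  fixes z :: "'a :: monoid_mult"
  assumes "z ^ M = 1" "z ^ d = 1" "d > 0" "\<And>r. 0 < r \<Longrightarrow> r < d \<Longrightarrow> z ^ r \<noteq> 1"
  shows "d dvd M"
proof -
  have "z ^ M = z ^ (d * (M div d) + M mod d)" by simp
  also have "\<dots> = z ^ (M mod d)"
    unfolding power_add power_mult using assms by simp
  finally have "M mod d = 0"
    using assms by (metis mod_less_divisor neq0_conv)
  then show ?thesis by auto
qed

text \<open>The condition reads \<open>z ^ 2 = - 1\<close>, so \<open>z\<close> has order 4.\<close>

lemma four_dvd_exponent:
  fixes z :: complex
  assumes "z ^ M = 1" "M > 0" "1 + z + inverse z = 1"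
  shows "4 dvd M"
proof (rule dvd_exponent_if_unity[OF assms(1)])
  have "z \<noteq> 0" using assms by (auto simp: zero_power)
  then have "z * (z + inverse z) = z ^ 2 + 1" by (simp add: power2_eq_square algebra_simps)
  then have 2: "z ^ 2 = - 1" using assms by (simp add: eq_neg_iff_add_eq_0)
  have 3: "z ^ 3 = - z" using 2 by (simp add: eval_nat_numeral)
  have "z \<noteq> 1" "z \<noteq> - 1" using 2 by auto
  moreover have "z ^ 4 = (z ^ 2) ^ 2" by (simp flip: power_mult)
  ultimately show "z ^ 4 = 1" "0 < r \<Longrightarrow> r < 4 \<Longrightarrow> z ^ r \<noteq> 1" for r
    using 2 3 by (auto simp: less_Suc_eq numeral_eq_Suc minus_equation_iff)
qed auto

text \<open>The condition reads \<open>z ^ 2 - z + 1 = 0\<close>, so \<open>z\<close> is a primitive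
  sixth root of unity.\<close>

lemma six_dvd_exponent:
  fixes z :: complex
  assumes "z ^ M = 1" "M > 0" "1 + z + inverse z = 2"
  shows "6 dvd M"
proof (rule dvd_exponent_if_unity[OF assms(1)])
  have "z \<noteq> 0" using assms by (auto simp: zero_power)
  then have "z * (1 + z + inverse z) = z + z ^ 2 + 1" by (simp add: power2_eq_square algebra_simps)
  then have 2: "z ^ 2 = z - 1" unfolding assms(3) by (simp add: algebra_simps)
  have "z ^ 3 = z * z ^ 2" by (simp add: eval_nat_numeral)
  also have "\<dots> = z * (z - 1)" using 2 by simp
  also have "\<dots> = z ^ 2 - z" by (simp add: power2_eq_square algebra_simps)
  finally have 3: "z ^ 3 = - 1" using 2 by simp
  have 4: "z ^ 4 = z * z ^ 3" and 5: "z ^ 5 = z ^ 2 * z ^ 3" and 6: "z ^ 6 = z ^ 3 * z ^ 3"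
    by (simp_all add: eval_nat_numeral)
  have ne: "z \<noteq> 1" "z \<noteq> - 1" "z ^ 2 \<noteq> 1" "z ^ 2 \<noteq> - 1" using 2 3 \<open>z \<noteq> 0\<close> by auto
  show "z ^ 6 = 1" using 6 3 by simp
  show "z ^ r \<noteq> 1" if "0 < r" "r < 6" for r
  proof -
    have "r = 1 \<or> r = 2 \<or> r = 3 \<or> r = 4 \<or> r = 5" using that by auto
    then show ?thesis
      using ne by (auto simp: 3 4 5 minus_equation_iff)
  qed
qed auto

section \<open>The board as a tensor product, and the construction for
  \<open>6 dvd n + 1\<close>\<close>

text \<open>The index \<open>i\<close> itself is included, so that a square together with its
  neighbors is a product of two such sets.\<close>

definition near :: "nat \<Rightarrow> nat \<Rightarrow> nat set" where
  "near n i = {k \<in> {1..n}. \<bar>int i - int k\<bar> \<le> 1}"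

text \<open>Zero values just outside both ends make the three-term formula valid at the border
  too.\<close>

lemma sum_near:
  fixes f :: "nat \<Rightarrow> 'a :: comm_ring_1"
  assumes "f 0 = 0" "f (Suc n) = 0" "i \<in> {1..n}"
  shows "sum f (near n i) = f (i - 1) + f i + f (i + 1)"
proof -
  have "f k = 0" if "k \<in> {i - 1, i, i + 1} - near n i" for k
  proof -
    have "k = 0 \<or> k = Suc n" using that assms(3) by (auto simp: near_def)
    then show ?thesis using assms by auto
  qed
  moreover have "near n i \<subseteq> {i - 1, i, i + 1}" by (auto simp: near_def)
  ultimately have "sum f (near n i) = sum f {i - 1, i, i + 1}"
    by (intro sum.mono_neutral_left) auto
  then show ?thesis using assms by (cases i) auto
qed

lemma neighbor_sum_property_near:
  "neighbor_sum_property n x \<longleftrightarrow>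
    (\<forall>i\<in>{1..n}. \<forall>j\<in>{1..n}. 2 * x (i, j) = sum x (near n i \<times> near n j))"
proof -
  have "sum x (near n i \<times> near n j) = x (i, j) + sum x {t \<in> squares n. neighbors (i, j) t}"
    if "i \<in> {1..n}" "j \<in> {1..n}" for i j
  proof -
    have "near n i \<times> near n j = insert (i, j) {t \<in> squares n. neighbors (i, j) t}"
      using that by (auto simp: near_def squares_def neighbors_def)
    moreover have "finite (squares n)" by (simp add: squares_def)
    ultimately show ?thesis by (simp add: neighbors_def)
  qed
  then show ?thesis
    by (auto simp: neighbor_sum_property_def squares_def)
qed

lemma exists_board:
  assumes "6 dvd n + 1"
  shows "\<exists>x. neighbor_sum_property n x \<and> \<not> trivial_board n x"
proof -
  \<comment> \<open>Up to scaling, \<open>u\<close> and \<open>v\<close> are the sine sequences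
    \<open>sin (pi * i / 2)\<close> and \<open>sin (pi * i / 3)\<close>, with eigenvalues
    \<open>1 + 2 * cos (pi / 2) = 1\<close> and \<open>1 + 2 * cos (pi / 3) = 2\<close>.\<close>
  define u :: "nat \<Rightarrow> int" where "u i = (if i mod 4 = 1 then 1 else if i mod 4 = 3 then -1 else 0)" for i
  define v :: "nat \<Rightarrow> int" where
    "v i = (if i mod 6 \<in> {1, 2} then 1 else if i mod 6 \<in> {4, 5} then -1 else 0)" for i
  have u0: "u 0 = 0" "v 0 = 0" by (simp_all add: u_def v_def)
  \<comment> \<open>The zeros of \<open>u\<close> are the even indices and those of \<open>v\<close>
    the multiples of 3, so both vanish at \<open>Suc n\<close>.\<close>
  have "even (Suc n)" "3 dvd Suc n" using assms by presburger+
  then have "Suc n mod 4 \<in> {0, 2}" "Suc n mod 6 \<in> {0, 3}"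
    by (simp_all add: dvd_eq_mod_eq_0; presburger)+
  then have un: "u (Suc n) = 0" "v (Suc n) = 0"
    by (auto simp: u_def v_def)
  have u: "u (i - 1) + u i + u (i + 1) = u i" and v: "v (i - 1) + v i + v (i + 1) = 2 * v i"
    if i: "i \<in> {1..n}" for i
  proof -
    obtain k where k: "i = Suc k" using i by (cases i) auto
    have "k mod 4 \<in> {0,1,2,3}" by auto
    then show "u (i - 1) + u i + u (i + 1) = u i"
      unfolding k u_def by (auto simp: mod_Suc)
    have "k mod 6 \<in> {0,1,2,3,4,5}" by auto
    then show "v (i - 1) + v i + v (i + 1) = 2 * v i"
      unfolding k v_def by (auto simp: mod_Suc)
  qed
  have near_u: "sum u (near n i) = u i" and near_v: "sum v (near n i) = 2 * v i"
    if "i \<in> {1..n}" for i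
    using sum_near[OF u0(1) un(1) that] sum_near[OF u0(2) un(2) that] u[OF that] v[OF that] by simp_all
  let ?x = "\<lambda>(i, j). u i * v j"
  have board: "neighbor_sum_property n ?x"
    unfolding neighbor_sum_property_near
    using near_u near_v
    by (auto simp: sum.cartesian_product[symmetric] sum_product[symmetric])
  have "n \<ge> 1" using assms by (cases n) auto
  then have "(1, 1) \<in> squares n" by (simp add: squares_def)
  moreover have "?x (1, 1) \<noteq> 0" by (simp add: u_def v_def)
  ultimately have "\<not> trivial_board n ?x" unfolding trivial_board_def by blast
  with board show ?thesis by blast
qed

section \<open>The discrete sine transform of a board\<close>

text \<open>For \<open>z = cis t\<close> this is \<open>2 * \<i> * sin (i * t)\<close>, the kernel
  of the sine transform.\<close>

definition wave :: "complex \<Rightarrow> nat \<Rightarrow> complex" where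
  "wave z i = z ^ i - inverse z ^ i"

lemma sum_near_wave:
  assumes "z ^ (2 * (n + 1)) = 1" "i \<in> {1..n}"
  shows "sum (wave z) (near n i) = (1 + z + inverse z) * wave z i"
proof -
  have z: "z \<noteq> 0" using assms by (auto simp: power_0_left)
  \<comment> \<open>Thus \<open>z ^ (n + 1)\<close> is its own inverse, which gives the zero
    boundary value at \<open>n + 1\<close>.\<close>
  have "z ^ (n + 1) * z ^ (n + 1) = 1"
    using assms(1) by (simp only: mult_2 power_add)
  then have "inverse z ^ (n + 1) = z ^ (n + 1)"
    by (metis inverse_unique power_inverse)
  then have "wave z (Suc n) = 0" by (simp add: wave_def)
  moreover have "wave z 0 = 0" by (simp add: wave_def)
  moreover obtain k where "i = Suc k" using assms by (cases i) auto
  moreover have cancel: "z * (inverse z * y) = y" for y using z by (simp flip: mult.assoc)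
  ultimately show ?thesis
    using assms(2) z by (simp add: sum_near wave_def algebra_simps cancel)
qed

text \<open>This is injectivity of the sine transform. Writing \<open>inverse z ^ k\<close> as
  \<open>z ^ (?M - k)\<close> turns the transform into a polynomial of degree below
  \<open>?M\<close>; vanishing at all \<open>?M\<close> roots of unity would make it zero.\<close>

lemma wave_coefficient_nonzero:
  fixes f :: "nat \<Rightarrow> complex"
  assumes "i \<in> {1..n}" "f i \<noteq> 0"
  obtains z where "z ^ (2 * (n + 1)) = 1" "(\<Sum>k\<in>{1..n}. f k * wave z k) \<noteq> 0"
proof (rule ccontr)
  assume "\<not> thesis"
  with that have zero: "(\<Sum>k\<in>{1..n}. f k * wave z k) = 0" if "z ^ (2 * (n + 1)) = 1" for z
    using \<open>z ^ (2 * (n + 1)) = 1\<close> by blast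
  let ?M = "2 * (n + 1)"
  define p where "p = (\<Sum>k\<in>{1..n}. monom (f k) k - monom (f k) (?M - k))"
  have "degree p \<le> ?M - 1"
    unfolding p_def by (intro degree_sum_le degree_diff_le order.trans[OF degree_monom_le]) auto
  then have "degree p < ?M" by simp
  have "p = 0"
  proof (rule poly_eqI_degree[where A = "{z. z ^ ?M = 1}"])
    fix z :: complex assume "z \<in> {z. z ^ ?M = 1}"
    then have z: "z ^ ?M = 1" by simp
    have "z ^ (?M - k) = inverse z ^ k" if "k \<in> {1..n}" for k
    proof -
      have "z ^ k * z ^ (?M - k) = 1"
        using that z by (simp flip: power_add)
      then show ?thesis by (metis inverse_unique power_inverse)
    qed
    then have "poly p z = (\<Sum>k\<in>{1..n}. f k * wave z k)"
      by (auto simp: p_def poly_sum poly_monom wave_def algebra_simps intro!: sum.cong)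
    then show "poly p z = poly 0 z" using zero z by simp
  qed (use \<open>degree p < ?M\<close> card_roots_unity_eq[of ?M] in auto)
  \<comment> \<open>The reflected exponents \<open>?M - k\<close> are at least \<open>n + 2\<close>,
    so they never meet \<open>i\<close>.\<close>
  moreover have "coeff p i = (\<Sum>k\<in>{1..n}. if k = i then f k else 0)"
    unfolding p_def coeff_sum using assms by (intro sum.cong) auto
  then have "coeff p i = f i" using assms by simp
  ultimately show False using assms by simp
qed

text \<open>A nonzero coefficient \<open>?X\<close> is found by transforming one coordinate at a
  time. The neighborhood operator is symmetric, so it can be moved from the board to the waves,
  where it acts as a scalar; comparing with \<open>2 * ?X\<close> gives the equation.\<close>

lemma board_imp_product_two:
  assumes x: "neighbor_sum_property n x" "\<not> trivial_board n x"
  obtains z w :: complex where "z ^ (2 * (n + 1)) = 1" "w ^ (2 * (n + 1)) = 1"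
    "(1 + z + inverse z) * (1 + w + inverse w) = 2"
proof -
  let ?I = "{1..n}"
  define c :: "nat \<Rightarrow> nat \<Rightarrow> complex" where "c i j = of_int (x (i, j))" for i j
  obtain i j where ij: "i \<in> ?I" "j \<in> ?I" "c i j \<noteq> 0"
    using x(2) by (auto simp: trivial_board_def squares_def c_def)
  obtain w where w: "w ^ (2 * (n + 1)) = 1" "(\<Sum>j\<in>?I. c i j * wave w j) \<noteq> 0"
    using wave_coefficient_nonzero[OF ij(2), of "c i"] ij(3) by blast
  obtain z where z: "z ^ (2 * (n + 1)) = 1"
    "(\<Sum>i\<in>?I. (\<Sum>j\<in>?I. c i j * wave w j) * wave z i) \<noteq> 0"
    using wave_coefficient_nonzero[OF ij(1), of "\<lambda>i. \<Sum>j\<in>?I. c i j * wave w j"] w(2) by blast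
  let ?X = "\<Sum>(i, j)\<in>?I \<times> ?I. c i j * (wave z i * wave w j)"
  have X: "?X \<noteq> 0"
    using z(2) by (simp add: sum.cartesian_product[symmetric] sum_distrib_left sum_distrib_right mult_ac)
  have "2 * ?X = (\<Sum>(i, j)\<in>?I \<times> ?I. (\<Sum>(k, m)\<in>near n i \<times> near n j. c k m) * (wave z i * wave w j))"
    unfolding sum_distrib_left
  proof (rule sum.cong; clarify)
    fix i j assume "i \<in> ?I" "j \<in> ?I"
    then have "2 * x (i, j) = sum x (near n i \<times> near n j)"
      using x(1) unfolding neighbor_sum_property_near by blast
    then have "of_int (2 * x (i, j)) = (of_int (sum x (near n i \<times> near n j)) :: complex)"
      by (rule arg_cong)
    then have "2 * c i j = (\<Sum>(k, m)\<in>near n i \<times> near n j. c k m)"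
      by (simp add: c_def case_prod_unfold)
    then show "2 * (c i j * (wave z i * wave w j)) =
      (\<Sum>(k, m)\<in>near n i \<times> near n j. c k m) * (wave z i * wave w j)"
      by (simp flip: mult.assoc)
  qed
  also have "\<dots> = (\<Sum>p\<in>?I \<times> ?I. \<Sum>q\<in>{q \<in> ?I \<times> ?I. q \<in> near n (fst p) \<times> near n (snd p)}.
      c (fst q) (snd q) * (wave z (fst p) * wave w (snd p)))"
    unfolding case_prod_unfold sum_distrib_right
    by (intro sum.cong refl) (auto simp: near_def)
  also have "\<dots> = (\<Sum>q\<in>?I \<times> ?I. \<Sum>p\<in>{p \<in> ?I \<times> ?I. q \<in> near n (fst p) \<times> near n (snd p)}.
      c (fst q) (snd q) * (wave z (fst p) * wave w (snd p)))"
    by (rule sum.swap_restrict) auto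
  \<comment> \<open>Symmetry of nearness enters here: the squares \<open>p\<close> having
    \<open>q\<close> nearby are those near \<open>q\<close>.\<close>
  also have "\<dots> = (\<Sum>q\<in>?I \<times> ?I. \<Sum>p\<in>near n (fst q) \<times> near n (snd q).
      c (fst q) (snd q) * (wave z (fst p) * wave w (snd p)))"
    by (intro sum.cong refl) (auto simp: near_def)
  also have "\<dots> = (\<Sum>(i, j)\<in>?I \<times> ?I. c i j * (sum (wave z) (near n i) * sum (wave w) (near n j)))"
    unfolding case_prod_unfold sum_product sum.cartesian_product by (simp only: sum_distrib_left)
  also have "\<dots> = (1 + z + inverse z) * (1 + w + inverse w) * ?X"
    unfolding sum_distrib_left[of "(1 + z + inverse z) * (1 + w + inverse w)"]
    by (intro sum.cong refl) (auto simp: sum_near_wave[OF z(1)] sum_near_wave[OF w(1)] mult_ac)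
  finally have "(1 + z + inverse z) * (1 + w + inverse w) = 2"
    using X by simp
  then show ?thesis using that z(1) w(1) by blast
qed

theorem theorem1:
  fixes n :: nat
  assumes "n \<ge> 3"
  shows "(\<exists>x :: nat \<times> nat \<Rightarrow> int. neighbor_sum_property n x \<and> \<not> trivial_board n x)
           \<longleftrightarrow> 6 dvd (n + 1)"
proof
  assume "\<exists>x :: nat \<times> nat \<Rightarrow> int. neighbor_sum_property n x \<and> \<not> trivial_board n x"
  then obtain z w :: complex where zw: "z ^ (2 * (n + 1)) = 1" "w ^ (2 * (n + 1)) = 1"
    "(1 + z + inverse z) * (1 + w + inverse w) = 2"
    using board_imp_product_two by blast
  have "4 dvd 2 * (n + 1) \<and> 6 dvd 2 * (n + 1)"
    using roots_of_unity_product_two[OF zw(1,2) _ zw(3)]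
      four_dvd_exponent[OF zw(1)] four_dvd_exponent[OF zw(2)]
      six_dvd_exponent[OF zw(1)] six_dvd_exponent[OF zw(2)] by auto
  then show "6 dvd n + 1" by presburger
qed (rule exists_board)

end
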